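(* Let $T$, $G$ and $H$ be digraphs. Then there is a natural strong homotopy equivalence of posets $$\overrightarrow{\mathrm{Hom}}(T, G \times H) \longrightarrow \overrightarrow{\mathrm{Hom}}(T, G) \times \overrightarrow{\mathrm{Hom}}(T,H).$$
   Context: A digraph $G$ consists of a finite vertex set $V(G)$ and an edge set $E(G)\subseteq V(G)\times V(G)$ (loops $(v,v)$ are allowed, and $(v,w)$ and $(w,v)$ may both be edges). The product $G\times H$ has vertex set $V(G)\times V(H)$, with $((g,h),(g',h'))$ an edge iff $(g,g')\in E(G)$ and $(h,h')\in E(H)$ (the categorical product). A multihomomorphism from $G$ to $H$ is a map $\alpha: V(G)\to 2^{V(H)}\setminus\{\emptyset\}$ such that $\alpha(v)\times\alpha(w)\subseteq E(H)$ for every $(v,w)\in E(G)$. As a poset, $\overrightarrow{\mathrm{Hom}}(G,H)$ is the set of all multihomomorphisms from $G$ to $H$ with $\alpha\le\beta$ iff $\alpha(v)\subseteq\beta(v)$ for all $v\in V(G)$. The product of posets $P\times Q$ has the componentwise order. For posets $P,Q$, $\mathrm{Poset}(P,Q)$ is the poset of order-preserving maps $P\to Q$ with $f\le g$ iff $f(x)\le g(x)$ for all $x$. Two order-preserving maps $P\to Q$ are strongly homotopic if they lie in the same connected component of (the order complex of) $\mathrm{Poset}(P,Q)$. An order-preserving map $f:P\to Q$ is a strong homotopy equivalence if there is an order-preserving $g:Q\to P$ such that $g\circ f$ and $f\circ g$ are strongly homotopic to the respective identities. The natural map is the one induced by the projections $G\times H\to G$ and $G\times H\to H$ (apply the projections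 to each set $\gamma(v)$). *)

theory Defs
  imports "HOL-Algebra.Order" "Graph_Theory.Pair_Digraph" "HOL-Library.FuncSet"
begin

text \<open>
  Digraphs are pairs of a finite vertex set and a set of ordered pairs of vertices, as in
  \<^locale>\<open>pair_fin_digraph\<close>, which allows loops and pairs of opposite edges.  (The locale
  \<^locale>\<open>pair_digraph\<close> excludes loops.)  Posets are \<^locale>\<open>partial_order\<close> records with an
  explicit carrier.
  Functions with a restricted domain are extensional on that domain, so that pointwise equality
  on the domain is equality and the pointwise orders below are antisymmetric.
\<close>

definition digraph_product ::
    "'a pair_pre_digraph \<Rightarrow> 'b pair_pre_digraph \<Rightarrow> ('a \<times> 'b) pair_pre_digraph" where
  "digraph_product G H =
     \<lparr>pverts = pverts G \<times> pverts H,
      parcs = {((g, h), (g', h')) | g h g' h'. (g, g') \<in> parcs G \<and> (h, h') \<in> parcs H}\<rparr>"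

definition multihoms ::
    "'t pair_pre_digraph \<Rightarrow> 'a pair_pre_digraph \<Rightarrow> ('t \<Rightarrow> 'a set) set" where
  "multihoms T G =
     {\<alpha> \<in> pverts T \<rightarrow>\<^sub>E (Pow (pverts G) - {{}}).
        \<forall>(v, w) \<in> parcs T. \<alpha> v \<times> \<alpha> w \<subseteq> parcs G}"

definition multihom_poset ::
    "'t pair_pre_digraph \<Rightarrow> 'a pair_pre_digraph \<Rightarrow> ('t \<Rightarrow> 'a set) gorder" where
  "multihom_poset T G =
     \<lparr>carrier = multihoms T G, eq = (=), le = (\<lambda>\<alpha> \<beta>. \<forall>v\<in>pverts T. \<alpha> v \<subseteq> \<beta> v)\<rparr>"

definition poset_product :: "'p gorder \<Rightarrow> 'q gorder \<Rightarrow> ('p \<times> 'q) gorder" where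
  "poset_product P Q =
     \<lparr>carrier = carrier P \<times> carrier Q, eq = (=),
      le = (\<lambda>(x, y) (x', y'). x \<sqsubseteq>\<^bsub>P\<^esub> x' \<and> y \<sqsubseteq>\<^bsub>Q\<^esub> y')\<rparr>"

definition poset_maps :: "'p gorder \<Rightarrow> 'q gorder \<Rightarrow> ('p \<Rightarrow> 'q) gorder" where
  "poset_maps P Q =
     \<lparr>carrier = {f \<in> carrier P \<rightarrow>\<^sub>E carrier Q. isotone P Q f}, eq = (=),
      le = (\<lambda>f g. \<forall>x\<in>carrier P. f x \<sqsubseteq>\<^bsub>Q\<^esub> g x)\<rparr>"

definition order_complex :: "'p gorder \<Rightarrow> 'p set set" where
  "order_complex P =
     {S. S \<subseteq> carrier P \<and> finite S \<and> S \<noteq> {} \<and> (\<forall>x\<in>S. \<forall>y\<in>S. x \<sqsubseteq>\<^bsub>P\<^esub> y \<or> y \<sqsubseteq>\<^bsub>P\<^esub> x)}"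

text \<open>
  Two vertices of an abstract simplicial complex \<open>K\<close> lie in the same connected component iff
  they are joined by an edge path.
\<close>

definition same_component :: "'v set set \<Rightarrow> 'v \<Rightarrow> 'v \<Rightarrow> bool" where
  "same_component K x y \<longleftrightarrow> {x} \<in> K \<and> {y} \<in> K \<and> (x, y) \<in> {(u, v). {u, v} \<in> K}\<^sup>*"

definition strongly_homotopic ::
    "'p gorder \<Rightarrow> 'q gorder \<Rightarrow> ('p \<Rightarrow> 'q) \<Rightarrow> ('p \<Rightarrow> 'q) \<Rightarrow> bool" where
  "strongly_homotopic P Q f g \<longleftrightarrow> same_component (order_complex (poset_maps P Q)) f g"

definition strong_homotopy_equivalence ::
    "'p gorder \<Rightarrow> 'q gorder \<Rightarrow> ('p \<Rightarrow> 'q) \<Rightarrow> bool" where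
  "strong_homotopy_equivalence P Q f \<longleftrightarrow>
     partial_order P \<and> partial_order Q \<and> f \<in> carrier (poset_maps P Q) \<and>
     (\<exists>g \<in> carrier (poset_maps Q P).
        strongly_homotopic P P (compose (carrier P) g f) (\<lambda>x\<in>carrier P. x) \<and>
        strongly_homotopic Q Q (compose (carrier Q) f g) (\<lambda>y\<in>carrier Q. y))"

definition multihom_push ::
    "'t pair_pre_digraph \<Rightarrow> ('a \<Rightarrow> 'b) \<Rightarrow> ('t \<Rightarrow> 'a set) \<Rightarrow> ('t \<Rightarrow> 'b set)" where
  "multihom_push T f \<gamma> = (\<lambda>v\<in>pverts T. f ` \<gamma> v)"

definition product_projection_map ::
    "'t pair_pre_digraph \<Rightarrow> 'a pair_pre_digraph \<Rightarrow> 'b pair_pre_digraph \<Rightarrow>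
     ('t \<Rightarrow> ('a \<times> 'b) set) \<Rightarrow> ('t \<Rightarrow> 'a set) \<times> ('t \<Rightarrow> 'b set)" where
  "product_projection_map T G H =
     (\<lambda>\<gamma>\<in>multihoms T (digraph_product G H). (multihom_push T fst \<gamma>, multihom_push T snd \<gamma>))"

end

theory Submission
  imports Defs
begin

text \<open>
  A multihomomorphism into \<open>G \<times> H\<close> assigns to every vertex a nonempty set of pairs, and projecting
  these sets remembers only the smallest box \<open>A \<times> B\<close> that contains each of them.  Conversely a pair
  of multihomomorphisms into \<open>G\<close> and \<open>H\<close> gives the multihomomorphism whose values are the boxes
  \<open>\<alpha> v \<times> \<beta> v\<close>.  Projecting a nonempty box returns its factors, and every set of pairs is contained
  in its bounding box, so the two maps form a Galois connection; the composite on the side of \<open>G \<times> H\<close> is the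
  closure operator that replaces every value by its bounding box.

  The order-theoretic part is that every Galois connection is a strong homotopy equivalence: the
  unit and the counit say that the two composites are comparable with the identities, and comparable
  maps span an edge of the order complex of the poset of maps
  (\<open>galois_connection_strong_homotopy_equivalence\<close>).  The graph-theoretic part is that the box of two
  multihomomorphisms and the projections of a multihomomorphism are again multihomomorphisms
  (\<open>multihom_box_in\<close>, \<open>multihom_push_in\<close>), because an edge of \<open>G \<times> H\<close> is exactly a pair of edges.
\<close>

lemma poset_maps_memI:
  assumes "partial_order P" and "partial_order Q" and "f \<in> carrier P \<rightarrow>\<^sub>E carrier Q"
    and "\<And>x y. \<lbrakk>x \<in> carrier P; y \<in> carrier P; x \<sqsubseteq>\<^bsub>P\<^esub> y\<rbrakk> \<Longrightarrow> f x \<sqsubseteq>\<^bsub>Q\<^esub> f y"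
  shows "f \<in> carrier (poset_maps P Q)"
proof -
  interpret P: partial_order P by fact
  interpret Q: partial_order Q by fact
  show ?thesis
    using assms by (auto simp: poset_maps_def
        intro!: isotoneI P.weak_partial_order_axioms Q.weak_partial_order_axioms)
qed

lemma poset_maps_memD:
  assumes "f \<in> carrier (poset_maps P Q)"
  shows "f \<in> carrier P \<rightarrow>\<^sub>E carrier Q"
    and "\<lbrakk>x \<in> carrier P; y \<in> carrier P; x \<sqsubseteq>\<^bsub>P\<^esub> y\<rbrakk> \<Longrightarrow> f x \<sqsubseteq>\<^bsub>Q\<^esub> f y"
  using assms by (auto simp: poset_maps_def isotone_def)

lemma identity_in_poset_maps:
  assumes "partial_order P"
  shows "(\<lambda>x\<in>carrier P. x) \<in> carrier (poset_maps P P)"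
  using assms by (intro poset_maps_memI) auto

lemma compose_in_poset_maps:
  assumes "partial_order P" and "partial_order R"
    and f: "f \<in> carrier (poset_maps P Q)" and g: "g \<in> carrier (poset_maps Q R)"
  shows "compose (carrier P) g f \<in> carrier (poset_maps P R)"
proof -
  have f_in: "f x \<in> carrier Q" if "x \<in> carrier P" for x
    using poset_maps_memD(1)[OF f] that by auto
  have g_in: "g y \<in> carrier R" if "y \<in> carrier Q" for y
    using poset_maps_memD(1)[OF g] that by auto
  show ?thesis
  proof (rule poset_maps_memI[OF assms(1,2)])
    show "compose (carrier P) g f \<in> carrier P \<rightarrow>\<^sub>E carrier R"
      using f_in g_in by (auto simp: compose_def)
  next
    fix x y assume "x \<in> carrier P" "y \<in> carrier P" "x \<sqsubseteq>\<^bsub>P\<^esub> y"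
    then show "compose (carrier P) g f x \<sqsubseteq>\<^bsub>R\<^esub> compose (carrier P) g f y"
      using f_in by (simp add: compose_eq poset_maps_memD(2)[OF f] poset_maps_memD(2)[OF g])
  qed
qed

text \<open>
  Comparable maps form a chain with at most two elements, which is a simplex of the order complex.
\<close>

lemma comparable_strongly_homotopic:
  assumes "partial_order Q"
    and f: "f \<in> carrier (poset_maps P Q)" and g: "g \<in> carrier (poset_maps P Q)"
    and le: "(\<forall>x\<in>carrier P. f x \<sqsubseteq>\<^bsub>Q\<^esub> g x) \<or> (\<forall>x\<in>carrier P. g x \<sqsubseteq>\<^bsub>Q\<^esub> f x)"
  shows "strongly_homotopic P Q f g"
proof -
  interpret Q: partial_order Q by fact
  have refl: "h \<sqsubseteq>\<^bsub>poset_maps P Q\<^esub> h" if "h \<in> carrier (poset_maps P Q)" for h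
    using poset_maps_memD(1)[OF that] by (auto simp: poset_maps_def)
  have "f \<sqsubseteq>\<^bsub>poset_maps P Q\<^esub> g \<or> g \<sqsubseteq>\<^bsub>poset_maps P Q\<^esub> f"
    using le by (simp add: poset_maps_def)
  then have "{f, g} \<in> order_complex (poset_maps P Q)"
    using f g refl by (auto simp: order_complex_def)
  moreover have "{f} \<in> order_complex (poset_maps P Q)" "{g} \<in> order_complex (poset_maps P Q)"
    using f g refl by (auto simp: order_complex_def)
  ultimately show ?thesis
    by (auto simp: strongly_homotopic_def same_component_def)
qed

lemma galois_connection_strong_homotopy_equivalence:
  assumes P: "partial_order P" and Q: "partial_order Q"
    and f: "f \<in> carrier (poset_maps P Q)" and g: "g \<in> carrier (poset_maps Q P)"
    and unit: "\<And>x. x \<in> carrier P \<Longrightarrow> x \<sqsubseteq>\<^bsub>P\<^esub> g (f x)"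
    and counit: "\<And>y. y \<in> carrier Q \<Longrightarrow> f (g y) \<sqsubseteq>\<^bsub>Q\<^esub> y"
  shows "strong_homotopy_equivalence P Q f"
proof -
  have "strongly_homotopic P P (compose (carrier P) g f) (\<lambda>x\<in>carrier P. x)"
    by (intro comparable_strongly_homotopic compose_in_poset_maps[OF P P f g]
        identity_in_poset_maps P) (simp add: compose_eq unit)
  moreover have "strongly_homotopic Q Q (compose (carrier Q) f g) (\<lambda>y\<in>carrier Q. y)"
    by (intro comparable_strongly_homotopic compose_in_poset_maps[OF Q Q g f]
        identity_in_poset_maps Q) (simp add: compose_eq counit)
  ultimately show ?thesis
    using P Q f g by (auto simp: strong_homotopy_equivalence_def)
qed

lemma multihoms_iff:
  "\<alpha> \<in> multihoms T G \<longleftrightarrow>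
     \<alpha> \<in> extensional (pverts T) \<and>
     (\<forall>v\<in>pverts T. \<alpha> v \<subseteq> pverts G \<and> \<alpha> v \<noteq> {}) \<and>
     (\<forall>v w x y. (v, w) \<in> parcs T \<longrightarrow> x \<in> \<alpha> v \<longrightarrow> y \<in> \<alpha> w \<longrightarrow> (x, y) \<in> parcs G)"
  unfolding multihoms_def PiE_def Pi_def by fast

lemma partial_order_multihom_poset: "partial_order (multihom_poset T G)"
proof
  fix \<alpha> \<beta>
  assume "\<alpha> \<sqsubseteq>\<^bsub>multihom_poset T G\<^esub> \<beta>" "\<beta> \<sqsubseteq>\<^bsub>multihom_poset T G\<^esub> \<alpha>"
    and "\<alpha> \<in> carrier (multihom_poset T G)" "\<beta> \<in> carrier (multihom_poset T G)"
  then show "\<alpha> .=\<^bsub>multihom_poset T G\<^esub> \<beta>"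
    by (auto simp: multihom_poset_def multihoms_iff intro!: extensionalityI[of \<alpha> "pverts T" \<beta>])
qed (fastforce simp: multihom_poset_def)+

lemma partial_order_poset_product:
  assumes "partial_order P" and "partial_order Q"
  shows "partial_order (poset_product P Q)"
proof -
  interpret P: partial_order P by fact
  interpret Q: partial_order Q by fact
  show ?thesis
    by standard (auto simp: poset_product_def intro: P.le_antisym Q.le_antisym P.le_trans Q.le_trans)
qed

definition multihom_box ::
    "'t pair_pre_digraph \<Rightarrow> ('t \<Rightarrow> 'a set) \<times> ('t \<Rightarrow> 'b set) \<Rightarrow> 't \<Rightarrow> ('a \<times> 'b) set" where
  "multihom_box T = (\<lambda>(\<alpha>, \<beta>). \<lambda>v\<in>pverts T. \<alpha> v \<times> \<beta> v)"

text \<open>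
  Edges of \<open>T\<close> have both ends in \<open>pverts T\<close>, here and in the next lemma, so that the edge condition
  only concerns the boxes (or images) themselves and never the default value that a restricted map
  takes outside of \<open>pverts T\<close>.
\<close>

lemma multihom_box_in:
  assumes "pair_wf_digraph T" and "\<alpha> \<in> multihoms T G" and "\<beta> \<in> multihoms T H"
  shows "multihom_box T (\<alpha>, \<beta>) \<in> multihoms T (digraph_product G H)"
proof -
  interpret pair_wf_digraph T by fact
  have "v \<in> pverts T" "w \<in> pverts T" if "(v, w) \<in> parcs T" for v w
    using that by (auto dest: in_arcsD1 in_arcsD2)
  then show ?thesis
    using assms(2,3) by (auto simp: multihoms_iff multihom_box_def digraph_product_def; blast)
qed

lemma multihom_push_in:
  assumes "pair_wf_digraph T" and "\<gamma> \<in> multihoms T K"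
    and verts: "\<And>x. x \<in> pverts K \<Longrightarrow> p x \<in> pverts G"
    and arcs: "\<And>x y. (x, y) \<in> parcs K \<Longrightarrow> (p x, p y) \<in> parcs G"
  shows "multihom_push T p \<gamma> \<in> multihoms T G"
proof -
  interpret pair_wf_digraph T by fact
  have "v \<in> pverts T" "w \<in> pverts T" if "(v, w) \<in> parcs T" for v w
    using that by (auto dest: in_arcsD1 in_arcsD2)
  then show ?thesis
    using assms(2) verts arcs by (fastforce simp: multihoms_iff multihom_push_def)
qed

lemma projections_of_multihom_in:
  assumes "pair_wf_digraph T" and "\<gamma> \<in> multihoms T (digraph_product G H)"
  shows "multihom_push T fst \<gamma> \<in> multihoms T G" and "multihom_push T snd \<gamma> \<in> multihoms T H"
  by (rule multihom_push_in[OF assms]; auto simp: digraph_product_def)+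

text \<open>Nonemptiness of both factors is what allows each of them to be recovered from the box.\<close>

lemma projections_of_box:
  assumes "\<alpha> \<in> multihoms T G" and "\<beta> \<in> multihoms T H"
  shows "multihom_push T fst (multihom_box T (\<alpha>, \<beta>)) = \<alpha>"
    and "multihom_push T snd (multihom_box T (\<alpha>, \<beta>)) = \<beta>"
  using assms
  by (auto simp: multihoms_iff multihom_push_def multihom_box_def fst_image_times snd_image_times
      intro!: extensionalityI[of _ "pverts T"])

lemma multihom_subset_bounding_box:
  assumes "v \<in> pverts T"
  shows "\<gamma> v \<subseteq> multihom_box T (multihom_push T fst \<gamma>, multihom_push T snd \<gamma>) v"
  using assms by (force simp: multihom_box_def multihom_push_def)

theorem proposition3p2:
  fixes T :: "'t pair_pre_digraph"
    and G :: "'a pair_pre_digraph"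
    and H :: "'b pair_pre_digraph"
  assumes "pair_fin_digraph T" and "pair_fin_digraph G" and "pair_fin_digraph H"
  shows "strong_homotopy_equivalence
           (multihom_poset T (digraph_product G H))
           (poset_product (multihom_poset T G) (multihom_poset T H))
           (product_projection_map T G H)"
proof -
  interpret T: pair_fin_digraph T by fact
  have wf: "pair_wf_digraph T" by (rule T.pair_wf_digraph_axioms)
  let ?P = "multihom_poset T (digraph_product G H)"
  let ?Q = "poset_product (multihom_poset T G) (multihom_poset T H)"
  let ?f = "product_projection_map T G H"
  \<comment> \<open>The inverse is restricted because maps of posets are extensional on the carrier.\<close>
  let ?g = "\<lambda>p\<in>multihoms T G \<times> multihoms T H. multihom_box T p"
  have P: "partial_order ?P" and Q: "partial_order ?Q"
    by (intro partial_order_multihom_poset partial_order_poset_product)+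
  have carriers: "carrier ?P = multihoms T (digraph_product G H)"
      "carrier ?Q = multihoms T G \<times> multihoms T H"
    by (simp_all add: multihom_poset_def poset_product_def)
  show ?thesis
  proof (rule galois_connection_strong_homotopy_equivalence[OF P Q])
    show "?f \<in> carrier (poset_maps ?P ?Q)"
    proof (rule poset_maps_memI[OF P Q])
      show "?f \<in> carrier ?P \<rightarrow>\<^sub>E carrier ?Q"
        unfolding carriers product_projection_map_def
        using projections_of_multihom_in[OF wf] by auto
    next
      fix \<gamma> \<delta> assume "\<gamma> \<in> carrier ?P" "\<delta> \<in> carrier ?P" "\<gamma> \<sqsubseteq>\<^bsub>?P\<^esub> \<delta>"
      then show "?f \<gamma> \<sqsubseteq>\<^bsub>?Q\<^esub> ?f \<delta>"
        by (simp add: multihom_poset_def poset_product_def product_projection_map_def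
            multihom_push_def image_mono)
    qed
    show "?g \<in> carrier (poset_maps ?Q ?P)"
    proof (rule poset_maps_memI[OF Q P])
      show "?g \<in> carrier ?Q \<rightarrow>\<^sub>E carrier ?P"
        unfolding carriers using multihom_box_in[OF wf] by auto
    next
      fix p q assume "p \<in> carrier ?Q" "q \<in> carrier ?Q" "p \<sqsubseteq>\<^bsub>?Q\<^esub> q"
      then show "?g p \<sqsubseteq>\<^bsub>?P\<^esub> ?g q"
        by (fastforce simp: multihom_poset_def poset_product_def multihom_box_def)
    qed
    show "\<gamma> \<sqsubseteq>\<^bsub>?P\<^esub> ?g (?f \<gamma>)" if "\<gamma> \<in> carrier ?P" for \<gamma>
      using that projections_of_multihom_in[OF wf, of \<gamma> G H] multihom_subset_bounding_box[of _ T \<gamma>]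
      by (simp add: multihom_poset_def product_projection_map_def)
    show "?f (?g p) \<sqsubseteq>\<^bsub>?Q\<^esub> p" if p: "p \<in> carrier ?Q" for p
    proof -
      obtain \<alpha> \<beta> where p_eq: "p = (\<alpha>, \<beta>)"
        and mem: "\<alpha> \<in> multihoms T G" "\<beta> \<in> multihoms T H"
        using p by (auto simp: carriers)
      have "?f (?g p) = p"
        by (simp add: p_eq mem product_projection_map_def multihom_box_in[OF wf mem]
            projections_of_box[OF mem])
      with p show ?thesis
        by (simp add: weak_partial_order.le_refl[OF partial_order.axioms(1)[OF Q]])
    qed
  qed
qed

end
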